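(* Let $(\mathcal{S}, \mathcal{A}\times\mathbb{R}_{>0}, \longrightarrow)$ be an action-labeled CTMC and let $s_1, s_2 \in \mathcal{S}$. Then $s_1 \sim_{\mathrm{FTABMB}} s_2$ (forward and time-abstract backward Markovian bisimilarity) if and only if $s_1 \sim_{\mathrm{MB}} s_2$ (Markovian bisimilarity).
   Context: An action-labeled CTMC is a triple $(\mathcal S,\mathcal A\times\mathbb R_{>0},\longrightarrow)$ with $\mathcal S$ a set of states, $\mathcal A$ a countable set of actions, and $\longrightarrow\subseteq\mathcal S\times(\mathcal A\times\mathbb R_{>0})\times\mathcal S$ a transition relation; write $s\xrightarrow{\langle a,\lambda\rangle}s'$. For $s\in\mathcal S$, $a\in\mathcal A$, $C\subseteq\mathcal S$, let $\mathrm{rate}(s,a,C)$ be the sum of the multiset $\{\!|\lambda \mid \exists s'\in C.\ s\xrightarrow{\langle a,\lambda\rangle}s'|\!\}$. An equivalence relation $\mathcal B$ on $\mathcal S$ is a Markovian bisimulation iff whenever $(s_1,s_2)\in\mathcal B$, $\mathrm{rate}(s_1,a,C)=\mathrm{rate}(s_2,a,C)$ for all $a\in\mathcal A$ and $C\in\mathcal S/\mathcal B$; $s_1\sim_{\mathrm{MB}}s_2$ iff some Markovian bisimulation contains $(s_1,s_2)$. A path of length $n$ from $s_0$ is a sequence $\xi=(s_0,\langle a_1,\lambda_1\rangle,s_1)\dots(s_{n-1},\langle a_n,\lambda_n\rangle,s_n)$ of transitions ($\epsilon$ the empty path); $\mathrm{last}(\xi)=s_n$. A run from $s$ is a pair $\rho=(s,\xi)$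 with $\xi$ a path from $s$ (possibly $\epsilon$); $\mathrm{last}(\rho)=\mathrm{last}(\xi)$, and $\mathrm{last}(\rho)=s$ if $\xi=\epsilon$. $\mathcal U$ denotes the set of all runs. Write $\rho\xrightarrow{\langle a,\lambda\rangle}\rho'$ iff $\rho'=(s,\xi\,(\mathrm{last}(\rho),\langle a,\lambda\rangle,s'))$ where $\rho=(s,\xi)$ and $\mathrm{last}(\rho)\xrightarrow{\langle a,\lambda\rangle}s'$. For $\rho\in\mathcal U$, $a\in\mathcal A$, $C\subseteq\mathcal U$: $\mathrm{rate}_o(\rho,a,C)$ is the sum of the multiset $\{\!|\lambda\mid\exists\rho'\in C.\ \rho\xrightarrow{\langle a,\lambda\rangle}\rho'|\!\}$, and $\mathrm{trans}_i(\rho,a,C)=1$ if there exist $\rho'\in C$ and $\lambda\in\mathbb R_{>0}$ with $\rho'\xrightarrow{\langle a,\lambda\rangle}\rho$, and $0$ otherwise. An equivalence relation $\mathcal B$ on $\mathcal U$ is a forward and time-abstract backward Markovian bisimulation iff whenever $(\rho_1,\rho_2)\in\mathcal B$, for all $a\in\mathcal A$ and $C\in\mathcal U/\mathcal B$: $\mathrm{rate}_o(\rho_1,a,C)=\mathrm{rate}_o(\rho_2,a,C)$ and $\mathrm{trans}_i(\rho_1,a,C)=\mathrm{trans}_i(\rho_2,a,C)$. $s_1\sim_{\mathrm{FTABMB}}s_2$ iff some such bisimulation contains $((s_1,\epsilon),(s_2,\epsilon))$. *)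

theory Defs
  imports "HOL-Analysis.Analysis"
begin

type_synonym ('s, 'a) trans_rel = "('s \<times> ('a \<times> real) \<times> 's) set"

definition action_labeled_ctmc :: "'s set \<Rightarrow> 'a set \<Rightarrow> ('s, 'a) trans_rel \<Rightarrow> bool" where
  "action_labeled_ctmc S A T \<longleftrightarrow> countable A \<and> T \<subseteq> S \<times> (A \<times> {0<..}) \<times> S"

text \<open>
  The multiset of rates contains one occurrence of \<open>l\<close> for each transition from \<open>s\<close> labeled
  \<open>(a, l)\<close> with target in \<open>C\<close>, so its sum is taken over the pairs \<open>(l, s')\<close>. No finiteness of
  branching is assumed; the sum of an infinite multiset of positive reals may be \<open>\<infinity>\<close>, hence
  the values in \<open>ennreal\<close>.
\<close>

definition rate :: "('s, 'a) trans_rel \<Rightarrow> 's \<Rightarrow> 'a \<Rightarrow> 's set \<Rightarrow> ennreal" where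
  "rate T s a C = (\<Sum>\<^sub>\<infinity>(l, s')\<in>{(l, s'). s' \<in> C \<and> (s, (a, l), s') \<in> T}. ennreal l)"

definition markovian_bisimulation ::
    "'s set \<Rightarrow> 'a set \<Rightarrow> ('s, 'a) trans_rel \<Rightarrow> ('s \<times> 's) set \<Rightarrow> bool" where
  "markovian_bisimulation S A T B \<longleftrightarrow>
     equiv S B \<and>
     (\<forall>(s1, s2)\<in>B. \<forall>a\<in>A. \<forall>C\<in>S // B. rate T s1 a C = rate T s2 a C)"

definition MB :: "'s set \<Rightarrow> 'a set \<Rightarrow> ('s, 'a) trans_rel \<Rightarrow> 's \<Rightarrow> 's \<Rightarrow> bool" where
  "MB S A T s1 s2 \<longleftrightarrow> (\<exists>B. markovian_bisimulation S A T B \<and> (s1, s2) \<in> B)"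

type_synonym ('s, 'a) path = "('s \<times> ('a \<times> real) \<times> 's) list"
type_synonym ('s, 'a) run = "'s \<times> ('s, 'a) path"

fun path_from :: "('s, 'a) trans_rel \<Rightarrow> 's \<Rightarrow> ('s, 'a) path \<Rightarrow> bool" where
  "path_from T s [] \<longleftrightarrow> True"
| "path_from T s ((s0, al, s1) # xi) \<longleftrightarrow> s0 = s \<and> (s0, al, s1) \<in> T \<and> path_from T s1 xi"

definition runs :: "'s set \<Rightarrow> ('s, 'a) trans_rel \<Rightarrow> ('s, 'a) run set" where
  "runs S T = {(s, xi). s \<in> S \<and> path_from T s xi}"

fun last_run :: "('s, 'a) run \<Rightarrow> 's" where
  "last_run (s, xi) = (if xi = [] then s else snd (snd (last xi)))"

definition run_trans :: "'s set \<Rightarrow> ('s, 'a) trans_rel \<Rightarrow> (('s, 'a) run, 'a) trans_rel" where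
  "run_trans S T =
     {((s, xi), (a, l), (s, xi @ [(last_run (s, xi), (a, l), s')])) | s xi a l s'.
        (s, xi) \<in> runs S T \<and> (last_run (s, xi), (a, l), s') \<in> T}"

definition rate_o :: "'s set \<Rightarrow> ('s, 'a) trans_rel \<Rightarrow>
    ('s, 'a) run \<Rightarrow> 'a \<Rightarrow> ('s, 'a) run set \<Rightarrow> ennreal" where
  "rate_o S T \<rho> a C = rate (run_trans S T) \<rho> a C"

definition trans_i :: "'s set \<Rightarrow> ('s, 'a) trans_rel \<Rightarrow>
    ('s, 'a) run \<Rightarrow> 'a \<Rightarrow> ('s, 'a) run set \<Rightarrow> nat" where
  "trans_i S T \<rho> a C =
     (if \<exists>\<rho>'\<in>C. \<exists>l>0. (\<rho>', (a, l), \<rho>) \<in> run_trans S T then 1 else 0)"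

definition ftab_markovian_bisimulation ::
    "'s set \<Rightarrow> 'a set \<Rightarrow> ('s, 'a) trans_rel \<Rightarrow> (('s, 'a) run \<times> ('s, 'a) run) set \<Rightarrow> bool" where
  "ftab_markovian_bisimulation S A T B \<longleftrightarrow>
     equiv (runs S T) B \<and>
     (\<forall>(\<rho>1, \<rho>2)\<in>B. \<forall>a\<in>A. \<forall>C\<in>runs S T // B.
        rate_o S T \<rho>1 a C = rate_o S T \<rho>2 a C \<and>
        trans_i S T \<rho>1 a C = trans_i S T \<rho>2 a C)"

definition FTABMB :: "'s set \<Rightarrow> 'a set \<Rightarrow> ('s, 'a) trans_rel \<Rightarrow> 's \<Rightarrow> 's \<Rightarrow> bool" where
  "FTABMB S A T s1 s2 \<longleftrightarrow>
     (\<exists>B. ftab_markovian_bisimulation S A T B \<and> ((s1, []), (s2, [])) \<in> B)"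

end

theory Submission
  imports Defs
begin

text \<open>
  Both directions transport an equivalence along \<^term>\<open>last_run\<close>. A Markovian bisimulation lifts
  to runs by relating them pointwise, ignoring rates: the predecessor of a run is then
  determined up to the lifted relation, which settles the backward condition. Conversely, the
  image of a bisimulation on runs generates an equivalence on states; the runs ending in one of
  its classes form a union of classes of runs, and rates are additive over disjoint unions.
\<close>

section \<open>One-step extensions of runs and additivity of rates\<close>

definition extend :: "('s, 'a) run \<Rightarrow> 'a \<Rightarrow> real \<Rightarrow> 's \<Rightarrow> ('s, 'a) run" where
  "extend \<rho> a l t = (fst \<rho>, snd \<rho> @ [(last_run \<rho>, (a, l), t)])"

lemma last_run_extend [simp]: "last_run (extend \<rho> a l t) = t"
  by (simp add: extend_def)

lemma path_from_snoc:
  "path_from T s (xi @ [(u, al, v)]) \<longleftrightarrow>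
     path_from T s xi \<and> u = last_run (s, xi) \<and> (u, al, v) \<in> T"
proof (induction xi arbitrary: s)
  case (Cons x xi)
  then show ?case by (cases x) auto
qed auto

lemma extend_in_runs_iff:
  "extend \<rho> a l t \<in> runs S T \<longleftrightarrow> \<rho> \<in> runs S T \<and> (last_run \<rho>, (a, l), t) \<in> T"
  by (cases \<rho>) (auto simp: extend_def runs_def path_from_snoc)

lemma run_trans_iff:
  "(\<rho>, (a, l), \<rho>') \<in> run_trans S T \<longleftrightarrow>
     \<rho> \<in> runs S T \<and> (\<exists>t. (last_run \<rho>, (a, l), t) \<in> T \<and> \<rho>' = extend \<rho> a l t)"
  by (cases \<rho>) (auto simp: run_trans_def extend_def)

lemma last_run_in_states:
  assumes "\<rho> \<in> runs S T" and "T \<subseteq> S \<times> L \<times> S"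
  shows "last_run \<rho> \<in> S"
proof (cases \<rho>)
  case (Pair s xi)
  with assms show ?thesis
    by (cases xi rule: rev_cases) (auto simp: runs_def path_from_snoc)
qed

text \<open>In \<open>ennreal\<close> an infinite sum is the supremum of its finite partial sums. A
  finite set of transitions meets only finitely many members of \<open>\<C>\<close>, and over
  finitely many disjoint members the sum splits, so both sides are the same supremum. Infinite
  families matter because a single class of states may be reached by infinitely many classes of
  runs.\<close>

lemma rate_Union:
  assumes "disjoint \<C>"
  shows "rate T s a (\<Union>\<C>) = (\<Sum>\<^sub>\<infinity>C\<in>\<C>. rate T s a C)"
proof -
  \<comment> \<open>Pairing each rate with its target keeps equal rates of distinct transitions
    apart and makes \<open>X C\<close> and \<open>X D\<close> disjoint whenever \<open>C\<close> and
    \<open>D\<close> are.\<close>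
  define X where "X C = {(l, s'). s' \<in> C \<and> (s, (a, l), s') \<in> T}" for C
  define f where "f = (\<lambda>(l, s' :: 'a). ennreal l)"
  have rate: "rate T s a C = infsum f (X C)" for C
    by (simp add: rate_def X_def f_def)
  have summable: "f summable_on Y" for Y
    by (simp add: nonneg_summable_on_complete)
  have mono: "infsum f Y \<le> infsum f Z" if "Y \<subseteq> Z" for Y Z
    using that by (intro infsum_mono_neutral summable) auto
  have finite_Union: "(\<Sum>C\<in>\<D>. infsum f (X C)) = infsum f (X (\<Union>\<D>))"
    if "finite \<D>" and "\<D> \<subseteq> \<C>" for \<D>
  proof -
    have "X C \<inter> X D = {}" if "C \<in> \<D>" and "D \<in> \<D>" and "C \<noteq> D" for C D
    proof -
      have "C \<inter> D = {}"
        using disjointD[OF assms] that \<open>\<D> \<subseteq> \<C>\<close> by (meson subsetD)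
      then show ?thesis
        by (auto simp: X_def)
    qed
    moreover have "(\<Union>C\<in>\<D>. X C) = X (\<Union>\<D>)"
      by (auto simp: X_def)
    ultimately show ?thesis
      using sum_infsum[OF \<open>finite \<D>\<close> summable, where B = X] by metis
  qed
  have "infsum f (X (\<Union>\<C>)) = (SUP F\<in>{F. finite F \<and> F \<subseteq> X (\<Union>\<C>)}. sum f F)"
    by (simp add: nonneg_infsum_complete)
  also have "\<dots> = (SUP \<D>\<in>{\<D>. finite \<D> \<and> \<D> \<subseteq> \<C>}. \<Sum>C\<in>\<D>. infsum f (X C))"
  proof (intro antisym SUP_least)
    fix F assume "F \<in> {F. finite F \<and> F \<subseteq> X (\<Union>\<C>)}"
    then have F: "finite F" "F \<subseteq> X (\<Union>\<C>)" by auto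
    then have "finite (snd ` F)" "snd ` F \<subseteq> \<Union>\<C>" by (auto simp: X_def)
    then obtain \<D> where \<D>: "finite \<D>" "\<D> \<subseteq> \<C>" "snd ` F \<subseteq> \<Union>\<D>"
      by (rule finite_subset_Union)
    then have "F \<subseteq> X (\<Union>\<D>)" using F by (fastforce simp: X_def)
    from mono[OF this] F have "sum f F \<le> (\<Sum>C\<in>\<D>. infsum f (X C))"
      by (simp add: finite_Union[OF \<D>(1,2)])
    also have "\<dots> \<le> (SUP \<D>\<in>{\<D>. finite \<D> \<and> \<D> \<subseteq> \<C>}. \<Sum>C\<in>\<D>. infsum f (X C))"
      using \<D> by (intro SUP_upper) auto
    finally show "sum f F \<le> (SUP \<D>\<in>{\<D>. finite \<D> \<and> \<D> \<subseteq> \<C>}. \<Sum>C\<in>\<D>. infsum f (X C))" .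
  next
    fix \<D> assume "\<D> \<in> {\<D>. finite \<D> \<and> \<D> \<subseteq> \<C>}"
    then have \<D>: "finite \<D>" "\<D> \<subseteq> \<C>" by auto
    then have "X (\<Union>\<D>) \<subseteq> X (\<Union>\<C>)" by (auto simp: X_def)
    from mono[OF this]
    show "(\<Sum>C\<in>\<D>. infsum f (X C)) \<le> (SUP F\<in>{F. finite F \<and> F \<subseteq> X (\<Union>\<C>)}. sum f F)"
      unfolding finite_Union[OF \<D>] using nonneg_infsum_complete[of "X (\<Union>\<C>)" f] by simp
  qed
  also have "\<dots> = (\<Sum>\<^sub>\<infinity>C\<in>\<C>. infsum f (X C))"
    by (simp add: nonneg_infsum_complete)
  finally show ?thesis
    by (simp add: rate)
qed

text \<open>The transitions leaving a run correspond bijectively to those leaving its last state,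
  with the same rates. Only the membership of \<open>a\<close>-extensions of this one run counts, so
  \<open>C\<close> can be a class of runs as well as a union of classes.\<close>

lemma rate_o_eq:
  assumes "\<rho> \<in> runs S T"
    and "\<And>l t. (last_run \<rho>, (a, l), t) \<in> T \<Longrightarrow> extend \<rho> a l t \<in> C \<longleftrightarrow> t \<in> D"
  shows "rate_o S T \<rho> a C = rate T (last_run \<rho>) a D"
proof -
  let ?h = "\<lambda>(l, t). (l, extend \<rho> a l t)"
  have "bij_betw ?h {(l, t). t \<in> D \<and> (last_run \<rho>, (a, l), t) \<in> T}
      {(l, \<rho>'). \<rho>' \<in> C \<and> (\<rho>, (a, l), \<rho>') \<in> run_trans S T}"
    using assms by (auto simp: bij_betw_def inj_on_def run_trans_iff extend_def image_iff)
  from infsum_reindex_bij_betw[OF this, of "\<lambda>(l, _). ennreal l"] show ?thesis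
    by (simp add: rate_o_def rate_def case_prod_unfold)
qed

section \<open>From bisimulations on runs to bisimulations on states\<close>

lemma FTABMB_imp_MB:
  assumes ctmc: "action_labeled_ctmc S A T" and "FTABMB S A T s1 s2"
  shows "MB S A T s1 s2"
proof -
  obtain B where B: "ftab_markovian_bisimulation S A T B" and s12: "((s1, []), (s2, [])) \<in> B"
    using assms unfolding FTABMB_def by blast
  have equiv: "equiv (runs S T) B"
    using B by (simp add: ftab_markovian_bisimulation_def)
  then have sub: "B \<subseteq> runs S T \<times> runs S T" and "refl_on (runs S T) B" and "sym B"
    by (auto simp: equiv_def)
  have T: "T \<subseteq> S \<times> (A \<times> {0<..}) \<times> S"
    using ctmc by (simp add: action_labeled_ctmc_def)
  define R where "R = map_prod last_run last_run ` B"
  have R: "R \<subseteq> S \<times> S"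
    using sub by (auto simp: R_def intro: last_run_in_states[OF _ T])
  have refl: "(s, s) \<in> R" if "s \<in> S" for s
  proof -
    have "((s, []), (s, [])) \<in> B"
      using that \<open>refl_on (runs S T) B\<close> by (auto simp: refl_on_def runs_def)
    then show ?thesis
      by (force simp: R_def)
  qed
  have "sym R"
    using \<open>sym B\<close> by (force simp: R_def sym_def)
  \<comment> \<open>\<open>R\<close> need not be transitive: runs with the same last state may lie
    in different classes of \<open>B\<close>. Hence the transitive closure.\<close>
  have equivR: "equiv S (R\<^sup>+)"
    using refl R \<open>sym R\<close>
    by (auto intro!: equivI refl_onI sym_trancl dest: trancl_subset_Sigma[THEN subsetD])
  have step: "rate T u a C = rate T v a C"
    if "(u, v) \<in> R" and "a \<in> A" and C: "C \<in> S // R\<^sup>+" for u v a C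
  proof -
    obtain \<rho> \<sigma> where \<rho>\<sigma>: "(\<rho>, \<sigma>) \<in> B" and uv: "u = last_run \<rho>" "v = last_run \<sigma>"
      using \<open>(u, v) \<in> R\<close> by (auto simp: R_def)
    \<comment> \<open>\<open>C\<close> is closed under \<open>R\<close>, so a class of runs with one
      run ending in \<open>C\<close> has all its runs ending there. Asking for inclusion therefore
      loses no run ending in \<open>C\<close>.\<close>
    define \<C> where "\<C> = {D \<in> runs S T // B. last_run ` D \<subseteq> C}"
    have disj: "disjoint \<C>"
      using quotient_disj[OF equiv] by (force simp: \<C>_def disjoint_def)
    have closed: "last_run \<tau> \<in> C" if "(\<pi>, \<tau>) \<in> B" and "last_run \<pi> \<in> C" for \<pi> \<tau>
    proof -
      have "(last_run \<pi>, last_run \<tau>) \<in> R\<^sup>+"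
        using that by (force simp: R_def)
      then show ?thesis
        using in_quotient_imp_closed[OF equivR C] that by blast
    qed
    have "\<Union>\<C> = {\<tau> \<in> runs S T. last_run \<tau> \<in> C}"
    proof (intro equalityI subsetI)
      fix \<tau> assume "\<tau> \<in> \<Union>\<C>"
      then show "\<tau> \<in> {\<tau> \<in> runs S T. last_run \<tau> \<in> C}"
        using in_quotient_imp_subset[OF equiv] by (fastforce simp: \<C>_def)
    next
      fix \<tau> assume \<tau>: "\<tau> \<in> {\<tau> \<in> runs S T. last_run \<tau> \<in> C}"
      then have "B `` {\<tau>} \<in> \<C>" and "\<tau> \<in> B `` {\<tau>}"
        using closed equiv_class_self[OF equiv] by (auto simp: \<C>_def quotientI)
      then show "\<tau> \<in> \<Union>\<C>" by blast
    qed
    then have rate: "rate T (last_run \<pi>) a C = rate_o S T \<pi> a (\<Union>\<C>)" if "\<pi> \<in> runs S T" for \<pi>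
      using that by (intro rate_o_eq[symmetric]) (auto simp: extend_in_runs_iff)
    have "rate_o S T \<rho> a D = rate_o S T \<sigma> a D" if "D \<in> \<C>" for D
      using B \<rho>\<sigma> \<open>a \<in> A\<close> that
      by (fastforce simp: \<C>_def ftab_markovian_bisimulation_def)
    then have "rate_o S T \<rho> a (\<Union>\<C>) = rate_o S T \<sigma> a (\<Union>\<C>)"
      unfolding rate_o_def rate_Union[OF disj] by (rule infsum_cong)
    moreover have "\<rho> \<in> runs S T" and "\<sigma> \<in> runs S T"
      using \<rho>\<sigma> sub by auto
    ultimately show ?thesis
      using rate by (simp add: uv)
  qed
  \<comment> \<open>Equality along single \<open>R\<close>-steps, for classes of the closure, chains
    along the closure.\<close>
  have "rate T u a C = rate T v a C"
    if "(u, v) \<in> R\<^sup>+" and "a \<in> A" and "C \<in> S // R\<^sup>+" for u v a C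
    using that by (induction rule: trancl_induct) (metis step)+
  then have "markovian_bisimulation S A T (R\<^sup>+)"
    using equivR by (auto simp: markovian_bisimulation_def)
  moreover have "(s1, s2) \<in> R\<^sup>+"
    using s12 by (force simp: R_def)
  ultimately show ?thesis
    by (auto simp: MB_def)
qed

section \<open>Lifting a relation on states to runs\<close>

definition step_rel :: "('s \<times> 's) set \<Rightarrow> 's \<times> ('a \<times> real) \<times> 's \<Rightarrow> 's \<times> ('a \<times> real) \<times> 's \<Rightarrow> bool"
  where "step_rel B = (\<lambda>(_, (a, _), t) (_, (b, _), t'). a = b \<and> (t, t') \<in> B)"

text \<open>Bisimilar states agree on total rates only, so matching steps may carry different rates
  and these are left free. Sources need no separate comparison: along a path each one is the start
  or the previous target. \<open>list_all2\<close> also forces equal length.\<close>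

definition run_rel :: "'s set \<Rightarrow> ('s, 'a) trans_rel \<Rightarrow> ('s \<times> 's) set \<Rightarrow>
    (('s, 'a) run \<times> ('s, 'a) run) set" where
  "run_rel S T B = {(\<rho>, \<sigma>). \<rho> \<in> runs S T \<and> \<sigma> \<in> runs S T \<and>
     (fst \<rho>, fst \<sigma>) \<in> B \<and> list_all2 (step_rel B) (snd \<rho>) (snd \<sigma>)}"

lemma equiv_run_rel:
  assumes "equiv S B" and T: "T \<subseteq> S \<times> L \<times> S"
  shows "equiv (runs S T) (run_rel S T B)"
proof -
  have refl: "\<And>s. s \<in> S \<Longrightarrow> (s, s) \<in> B"
    and sym: "\<And>s t. (s, t) \<in> B \<Longrightarrow> (t, s) \<in> B"
    and trans: "\<And>s t u. (s, t) \<in> B \<Longrightarrow> (t, u) \<in> B \<Longrightarrow> (s, u) \<in> B"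
    using assms by (auto simp: equiv_def refl_on_def dest: symD transD)
  \<comment> \<open>\<open>B\<close> is reflexive on \<open>S\<close> only; the induction works
    because targets of transitions lie in \<open>S\<close>.\<close>
  have "list_all2 (step_rel B) xi xi" if "path_from T s xi" for s and xi :: "('a, 'b) path"
    using that
  proof (induction xi arbitrary: s)
    case (Cons x xi)
    then show ?case using T refl by (cases x) (auto simp: step_rel_def)
  qed simp
  then have refl': "(\<rho>, \<rho>) \<in> run_rel S T B" if "\<rho> \<in> runs S T" for \<rho>
    using that refl by (auto simp: run_rel_def runs_def)
  have sym': "(\<sigma>, \<rho>) \<in> run_rel S T B" if "(\<rho>, \<sigma>) \<in> run_rel S T B" for \<rho> \<sigma>
  proof -
    have "list_all2 (step_rel B) (snd \<sigma>) (snd \<rho>)"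
      using that sym by (auto simp: run_rel_def step_rel_def list_all2_conv_all_nth case_prod_unfold)
    then show ?thesis
      using that sym by (auto simp: run_rel_def)
  qed
  have "transp (step_rel B :: 'a \<times> ('b \<times> real) \<times> 'a \<Rightarrow> _)"
    by (rule transpI) (auto simp: step_rel_def intro: trans)
  note step_trans = transpD[OF list.rel_transp[OF this]]
  have trans': "(\<rho>, \<tau>) \<in> run_rel S T B"
    if "(\<rho>, \<sigma>) \<in> run_rel S T B" and "(\<sigma>, \<tau>) \<in> run_rel S T B" for \<rho> \<sigma> \<tau>
  proof -
    have "list_all2 (step_rel B) (snd \<rho>) (snd \<sigma>)" "list_all2 (step_rel B) (snd \<sigma>) (snd \<tau>)"
      using that by (auto simp: run_rel_def)
    then have "list_all2 (step_rel B) (snd \<rho>) (snd \<tau>)"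
      by (rule step_trans)
    moreover have "(fst \<rho>, fst \<tau>) \<in> B"
      using that by (auto simp: run_rel_def intro: trans)
    ultimately show ?thesis
      using that by (simp add: run_rel_def)
  qed
  show ?thesis
  proof (intro equivI)
    show "run_rel S T B \<subseteq> runs S T \<times> runs S T"
      by (auto simp: run_rel_def)
    show "refl_on (runs S T) (run_rel S T B)"
      by (rule refl_onI) (rule refl')
    show "sym (run_rel S T B)"
      by (rule symI) (rule sym')
    show "trans (run_rel S T B)"
      by (rule transI) (rule trans')
  qed
qed

text \<open>The last step splits off, so the class of an extension is determined by the class of its
  prefix, the action and the class of the target.\<close>

lemma run_rel_extend_iff:
  assumes "(last_run \<rho>, (a, l), t) \<in> T" and "(last_run \<sigma>, (b, m), u) \<in> T"
  shows "(extend \<rho> a l t, extend \<sigma> b m u) \<in> run_rel S T B \<longleftrightarrow>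
    (\<rho>, \<sigma>) \<in> run_rel S T B \<and> a = b \<and> (t, u) \<in> B"
proof -
  \<comment> \<open>Reversing both lists turns the appended elements into heads.\<close>
  have "list_all2 P (xs @ [x]) (ys @ [y]) \<longleftrightarrow> list_all2 P xs ys \<and> P x y" for P 
    and xs ys :: "('a \<times> ('b \<times> real) \<times> 'a) list" and x y
    using list_all2_rev[of P "xs @ [x]" "ys @ [y]"] list_all2_rev[of P xs ys] by auto
  with assms show ?thesis
    unfolding run_rel_def by (auto simp: extend_in_runs_iff) (auto simp: extend_def step_rel_def)
qed

lemma run_cases:
  assumes "\<rho> \<in> runs S T"
  obtains s where "\<rho> = (s, [])"
  | \<rho>' a l t where "\<rho>' \<in> runs S T" "(last_run \<rho>', (a, l), t) \<in> T" "\<rho> = extend \<rho>' a l t"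
proof (cases "snd \<rho>" rule: rev_cases)
  case Nil
  then show ?thesis using that(1) by (metis prod.collapse)
next
  case (snoc xi x)
  obtain u a l t where x: "x = (u, (a, l), t)" by (metis prod.collapse)
  with snoc assms have "\<rho> = extend (fst \<rho>, xi) a l t"
    by (cases \<rho>) (auto simp: extend_def runs_def path_from_snoc)
  with assms that(2) show ?thesis by (metis extend_in_runs_iff)
qed

text \<open>Equal length rules out an empty \<open>\<sigma>\<close>, so it too has a last step to
  split off.\<close>

lemma run_rel_extendE:
  assumes "(extend \<rho> a l t, \<sigma>) \<in> run_rel S T B"
  obtains \<sigma>' m u where "\<sigma> = extend \<sigma>' a m u" "(last_run \<sigma>', (a, m), u) \<in> T"
    "(\<rho>, \<sigma>') \<in> run_rel S T B" "(t, u) \<in> B"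
proof -
  have "\<sigma> \<in> runs S T"
    using assms by (simp add: run_rel_def)
  then show ?thesis
  proof (cases rule: run_cases)
    case (1 s)
    with assms show ?thesis by (simp add: run_rel_def extend_def)
  next
    case (2 \<sigma>' b m u)
    moreover have "(last_run \<rho>, (a, l), t) \<in> T"
      using assms by (simp add: run_rel_def extend_in_runs_iff)
    ultimately show ?thesis
      using assms that run_rel_extend_iff by metis
  qed
qed

lemma run_rel_last_run:
  assumes "(\<rho>, \<sigma>) \<in> run_rel S T B"
  shows "(last_run \<rho>, last_run \<sigma>) \<in> B"
proof -
  have "\<rho> \<in> runs S T"
    using assms by (simp add: run_rel_def)
  then show ?thesis
  proof (cases rule: run_cases)
    case (1 s)
    with assms show ?thesis by (cases \<sigma>) (simp add: run_rel_def)
  next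
    case (2 \<rho>' a l t)
    with assms show ?thesis by (auto elim: run_rel_extendE)
  qed
qed

section \<open>The lifted relation is a bisimulation on runs\<close>

lemma MB_imp_FTABMB:
  assumes ctmc: "action_labeled_ctmc S A T" and "s1 \<in> S" and "s2 \<in> S"
    and "MB S A T s1 s2"
  shows "FTABMB S A T s1 s2"
proof -
  obtain B where B: "markovian_bisimulation S A T B" and s12: "(s1, s2) \<in> B"
    using assms unfolding MB_def by blast
  have equivB: "equiv S B"
    using B by (simp add: markovian_bisimulation_def)
  have T: "T \<subseteq> S \<times> (A \<times> {0<..}) \<times> S"
    using ctmc by (simp add: action_labeled_ctmc_def)
  let ?B = "run_rel S T B"
  have equiv: "equiv (runs S T) ?B"
    using equivB T by (rule equiv_run_rel)
  have sym: "(\<sigma>, \<rho>) \<in> ?B" if "(\<rho>, \<sigma>) \<in> ?B" for \<rho> \<sigma>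
    using equiv that by (auto simp: equiv_def dest: symD)
  \<comment> \<open>Once \<open>C\<close> contains some \<open>a\<close>-extension of a run related
    to \<open>\<rho>\<close>, it is the class of that extension, and an \<open>a\<close>-extension
    of \<open>\<rho>\<close> falls into it exactly when its target is related to
    \<open>t\<close>.\<close>
  have rate_class: "rate_o S T \<rho> a C = rate T (last_run \<rho>) a (B `` {t})"
    if \<sigma>\<rho>: "(\<sigma>, \<rho>) \<in> ?B" and C: "C \<in> runs S T // ?B" and ext: "extend \<sigma> a l t \<in> C"
    for \<rho> \<sigma> a l t C
  proof (rule rate_o_eq)
    show "\<rho> \<in> runs S T"
      using \<sigma>\<rho> by (simp add: run_rel_def)
    fix m u assume u: "(last_run \<rho>, (a, m), u) \<in> T"
    have "extend \<sigma> a l t \<in> runs S T"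
      using in_quotient_imp_subset[OF equiv C] ext by blast
    then have t: "(last_run \<sigma>, (a, l), t) \<in> T"
      by (simp add: extend_in_runs_iff)
    have "extend \<rho> a m u \<in> C \<longleftrightarrow> (extend \<sigma> a l t, extend \<rho> a m u) \<in> ?B"
      using in_quotient_imp_closed[OF equiv C ext] in_quotient_imp_in_rel[OF equiv C] ext by blast
    then show "extend \<rho> a m u \<in> C \<longleftrightarrow> u \<in> B `` {t}"
      using run_rel_extend_iff[OF t u] \<sigma>\<rho> by auto
  qed
  have rate_eq: "rate_o S T \<rho> a C = rate_o S T \<sigma> a C"
    if \<rho>\<sigma>: "(\<rho>, \<sigma>) \<in> ?B" and "a \<in> A" and C: "C \<in> runs S T // ?B"
      and ext: "extend \<rho> a l t \<in> C" for \<rho> \<sigma> a l t C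
  proof -
    \<comment> \<open>\<open>rate_class\<close> is applied to \<open>\<rho>\<close> and to
      \<open>\<sigma>\<close> with the same representative \<open>extend \<rho> a l t\<close>. Both
      rates then refer to the class of \<open>t\<close>, where the bisimulation condition on states
      applies.\<close>
    have "(\<rho>, \<rho>) \<in> ?B"
      using \<rho>\<sigma> equiv by (auto simp: run_rel_def equiv_def refl_on_def)
    moreover have "extend \<rho> a l t \<in> runs S T"
      using in_quotient_imp_subset[OF equiv C] ext by blast
    then have "t \<in> S"
      using last_run_in_states[OF _ T] by fastforce
    then have "rate T (last_run \<rho>) a (B `` {t}) = rate T (last_run \<sigma>) a (B `` {t})"
      using B \<open>a \<in> A\<close> run_rel_last_run[OF \<rho>\<sigma>]
      by (fastforce simp: markovian_bisimulation_def intro: quotientI)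
    ultimately show ?thesis
      using rate_class[OF _ C ext] \<rho>\<sigma> by simp
  qed
  have rate: "rate_o S T \<rho> a C = rate_o S T \<sigma> a C"
    if "(\<rho>, \<sigma>) \<in> ?B" and "a \<in> A" and "C \<in> runs S T // ?B" for \<rho> \<sigma> a C
  proof (cases "\<exists>l t. extend \<rho> a l t \<in> C \<or> extend \<sigma> a l t \<in> C")
    case True
    then show ?thesis using rate_eq that sym by metis
  next
    \<comment> \<open>Neither run has an \<open>a\<close>-extension in \<open>C\<close>, so both
      rates are empty sums.\<close>
    case False
    then have "rate_o S T \<pi> a C = rate T (last_run \<pi>) a {}" if "\<pi> \<in> {\<rho>, \<sigma>}" for \<pi>
      using that \<open>(\<rho>, \<sigma>) \<in> ?B\<close> by (intro rate_o_eq) (auto simp: run_rel_def)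
    then show ?thesis by (simp add: rate_def)
  qed
  \<comment> \<open>The only predecessor of a run is its prefix, and prefixes of related runs are
    related, hence in the same class. The rate \<open>m\<close> may differ from \<open>l\<close>,
    which the time-abstract condition allows.\<close>
  have backward: "\<exists>\<sigma>'\<in>C. \<exists>m>0. (\<sigma>', (a, m), \<sigma>) \<in> run_trans S T"
    if \<rho>\<sigma>: "(\<rho>, \<sigma>) \<in> ?B" and C: "C \<in> runs S T // ?B"
      and \<rho>': "\<rho>' \<in> C" "(\<rho>', (a, l), \<rho>) \<in> run_trans S T" for \<rho> \<sigma> a C l \<rho>'
  proof -
    obtain t where "\<rho> = extend \<rho>' a l t"
      using \<rho>' by (auto simp: run_trans_iff)
    with \<rho>\<sigma> obtain \<sigma>' m u where \<sigma>': "\<sigma> = extend \<sigma>' a m u" "(last_run \<sigma>', (a, m), u) \<in> T"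
      "(\<rho>', \<sigma>') \<in> ?B"
      by (auto elim: run_rel_extendE)
    then have "\<sigma>' \<in> C" and "m > 0" and "\<sigma>' \<in> runs S T"
      using in_quotient_imp_closed[OF equiv C \<rho>'(1)] T by (auto simp: run_rel_def)
    with \<sigma>' show ?thesis
      by (auto simp: run_trans_iff)
  qed
  \<comment> \<open>Using \<open>backward\<close> in both directions makes the two indicator values
    agree.\<close>
  have "trans_i S T \<rho> a C = trans_i S T \<sigma> a C"
    if "(\<rho>, \<sigma>) \<in> ?B" and "C \<in> runs S T // ?B" for \<rho> \<sigma> a C
    unfolding trans_i_def using backward[OF that] backward[OF sym[OF that(1)] that(2)] by metis
  with rate have "ftab_markovian_bisimulation S A T ?B"
    using equiv by (auto simp: ftab_markovian_bisimulation_def)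
  moreover have "((s1, []), (s2, [])) \<in> ?B"
    using s12 assms by (simp add: run_rel_def runs_def)
  ultimately show ?thesis
    by (auto simp: FTABMB_def)
qed

theorem theorem5p7:
  fixes S :: "'s set" and A :: "'a set" and T :: "('s \<times> ('a \<times> real) \<times> 's) set"
    and s1 s2 :: 's
  assumes "action_labeled_ctmc S A T"
    and "s1 \<in> S" and "s2 \<in> S"
  shows "FTABMB S A T s1 s2 \<longleftrightarrow> MB S A T s1 s2"
  using assms FTABMB_imp_MB MB_imp_FTABMB by metis

end
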